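(* The group $\mathbf{Z}\wr(\mathbf{Z}\times\mathbf{Z})$ does not embed in $PL_o(I)$; that is, there is no injective group homomorphism $\mathbf{Z}\wr(\mathbf{Z}\times\mathbf{Z})\to PL_o(I)$.
   Context: $I=[0,1]$. $PL_o(I)$ is the group, under composition, of orientation-preserving piecewise-linear homeomorphisms of $I$ with finitely many breaks in slope. $C\wr T$ denotes the standard restricted wreath product, i.e. the semidirect product $\left(\bigoplus_{t\in T}C\right)\rtimes T$, where $\bigoplus_{t\in T} C$ is the group of finitely supported functions $T\to C$ and $T$ acts by translating coordinates via its regular action on itself. *)

theory Defs
  imports "HOL-Algebra.Product_Groups" "HOL-Algebra.Bij" "HOL-Analysis.Analysis"
begin

text \<open>The semidirect product of \<open>N\<close> and \<open>H\<close> with respect to an action \<open>\<alpha>\<close> of \<open>H\<close> on \<open>N\<close> by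
  automorphisms.\<close>

definition semidirect_product ::
    "('a, 'm) monoid_scheme \<Rightarrow> ('b, 'n) monoid_scheme \<Rightarrow> ('b \<Rightarrow> 'a \<Rightarrow> 'a) \<Rightarrow> ('a \<times> 'b) monoid"
  where "semidirect_product N H \<alpha> =
    \<lparr>carrier = carrier N \<times> carrier H,
     monoid.mult = (\<lambda>(x, s) (y, t). (x \<otimes>\<^bsub>N\<^esub> \<alpha> s y, s \<otimes>\<^bsub>H\<^esub> t)),
     one = (\<one>\<^bsub>N\<^esub>, \<one>\<^bsub>H\<^esub>)\<rparr>"

definition translate :: "('b, 'n) monoid_scheme \<Rightarrow> 'b \<Rightarrow> ('b \<Rightarrow> 'a) \<Rightarrow> 'b \<Rightarrow> 'a"
  where "translate T s f = (\<lambda>x\<in>carrier T. f (inv\<^bsub>T\<^esub> s \<otimes>\<^bsub>T\<^esub> x))"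

definition wreath_product ::
    "('a, 'm) monoid_scheme \<Rightarrow> ('b, 'n) monoid_scheme \<Rightarrow> (('b \<Rightarrow> 'a) \<times> 'b) monoid"
  where "wreath_product C T = semidirect_product (sum_group (carrier T) (\<lambda>_. C)) T (translate T)"

text \<open>The set \<open>B\<close> contains all the points where the slope changes.  It need not be minimal.\<close>

definition finitely_piecewise_linear_on :: "real set \<Rightarrow> (real \<Rightarrow> real) \<Rightarrow> bool"
  where "finitely_piecewise_linear_on S f \<longleftrightarrow>
    (\<exists>B. finite B \<and>
      (\<forall>a b. {a<..<b} \<subseteq> S - B \<longrightarrow> (\<exists>m c. \<forall>x\<in>{a<..<b}. f x = m * x + c)))"

text \<open>Functions are extensional on the unit interval, as for \<^const>\<open>BijGroup\<close>, so that
  each homeomorphism is represented exactly once.\<close>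

definition PLo_carrier :: "(real \<Rightarrow> real) set"
  where "PLo_carrier =
    {f \<in> Bij {0..1}. (\<exists>g. homeomorphism {0..1} {0..1} f g) \<and> strict_mono_on {0..1} f \<and>
      finitely_piecewise_linear_on {0..1} f}"

definition PLo :: "(real \<Rightarrow> real) monoid"
  where "PLo = BijGroup {0..1} \<lparr>carrier := PLo_carrier\<rparr>"

lemma group_semidirect_product:
  assumes N: "group N" and H: "group H"
    and closed: "\<And>s x. s \<in> carrier H \<Longrightarrow> x \<in> carrier N \<Longrightarrow> \<alpha> s x \<in> carrier N"
    and mult: "\<And>s x y. s \<in> carrier H \<Longrightarrow> x \<in> carrier N \<Longrightarrow> y \<in> carrier N \<Longrightarrow>
      \<alpha> s (x \<otimes>\<^bsub>N\<^esub> y) = \<alpha> s x \<otimes>\<^bsub>N\<^esub> \<alpha> s y"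
    and one: "\<And>x. x \<in> carrier N \<Longrightarrow> \<alpha> \<one>\<^bsub>H\<^esub> x = x"
    and act: "\<And>s t x. s \<in> carrier H \<Longrightarrow> t \<in> carrier H \<Longrightarrow> x \<in> carrier N \<Longrightarrow>
      \<alpha> (s \<otimes>\<^bsub>H\<^esub> t) x = \<alpha> s (\<alpha> t x)"
  shows "group (semidirect_product N H \<alpha>)"
proof -
  interpret N: group N by fact
  interpret H: group H by fact
  show ?thesis
  proof (rule groupI)
    fix p assume p: "p \<in> carrier (semidirect_product N H \<alpha>)"
    then obtain x s where ps: "p = (x, s)" "x \<in> carrier N" "s \<in> carrier H"
      by (auto simp: semidirect_product_def)
    let ?q = "(\<alpha> (inv\<^bsub>H\<^esub> s) (inv\<^bsub>N\<^esub> x), inv\<^bsub>H\<^esub> s)"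
    have fix_one: "\<alpha> t \<one>\<^bsub>N\<^esub> = \<one>\<^bsub>N\<^esub>" if t: "t \<in> carrier H" for t
    proof -
      have "\<alpha> t \<one>\<^bsub>N\<^esub> \<otimes>\<^bsub>N\<^esub> \<alpha> t \<one>\<^bsub>N\<^esub> = \<alpha> t \<one>\<^bsub>N\<^esub>"
        using mult[OF t, of "\<one>\<^bsub>N\<^esub>" "\<one>\<^bsub>N\<^esub>"] by simp
      then show ?thesis using closed[OF t, of "\<one>\<^bsub>N\<^esub>"] N.l_cancel_one by simp
    qed
    have "?q \<otimes>\<^bsub>semidirect_product N H \<alpha>\<^esub> p = \<one>\<^bsub>semidirect_product N H \<alpha>\<^esub>"
      using ps by (simp add: semidirect_product_def fix_one flip: mult)
    moreover have "?q \<in> carrier (semidirect_product N H \<alpha>)"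
      using ps closed by (simp add: semidirect_product_def)
    ultimately show "\<exists>q\<in>carrier (semidirect_product N H \<alpha>).
        q \<otimes>\<^bsub>semidirect_product N H \<alpha>\<^esub> p = \<one>\<^bsub>semidirect_product N H \<alpha>\<^esub>" by blast
  qed (auto simp: semidirect_product_def closed mult one act N.m_assoc H.m_assoc)
qed

lemma translate_in_carrier:
  assumes C: "group C" and T: "group T" and s: "s \<in> carrier T"
    and f: "f \<in> carrier (sum_group (carrier T) (\<lambda>_. C))"
  shows "translate T s f \<in> carrier (sum_group (carrier T) (\<lambda>_. C))"
proof -
  interpret T: group T by fact
  have fin: "finite {x \<in> carrier T. f x \<noteq> \<one>\<^bsub>C\<^esub>}"
    using f C by (simp add: carrier_sum_group)
  have "{x \<in> carrier T. translate T s f x \<noteq> \<one>\<^bsub>C\<^esub>}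
      \<subseteq> (\<lambda>x. s \<otimes>\<^bsub>T\<^esub> x) ` {x \<in> carrier T. f x \<noteq> \<one>\<^bsub>C\<^esub>}"
  proof
    fix x assume x: "x \<in> {x \<in> carrier T. translate T s f x \<noteq> \<one>\<^bsub>C\<^esub>}"
    then have "x = s \<otimes>\<^bsub>T\<^esub> (inv\<^bsub>T\<^esub> s \<otimes>\<^bsub>T\<^esub> x)"
      using s by (simp flip: T.m_assoc)
    then show "x \<in> (\<lambda>x. s \<otimes>\<^bsub>T\<^esub> x) ` {x \<in> carrier T. f x \<noteq> \<one>\<^bsub>C\<^esub>}"
      using x s by (intro image_eqI) (auto simp: translate_def)
  qed
  then have "finite {x \<in> carrier T. translate T s f x \<noteq> \<one>\<^bsub>C\<^esub>}"
    using fin finite_surj by blast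
  then show ?thesis
    using f C s by (auto simp: carrier_sum_group translate_def PiE_iff)
qed

lemma group_wreath_product:
  assumes C: "group C" and T: "group T"
  shows "group (wreath_product C T)"
proof -
  interpret C: group C by fact
  interpret T: group T by fact
  show ?thesis
    unfolding wreath_product_def
  proof (rule group_semidirect_product)
    fix f assume "f \<in> carrier (sum_group (carrier T) (\<lambda>_. C))"
    then have "f \<in> extensional (carrier T)"
      by (simp add: C.group_axioms carrier_sum_group PiE_iff)
    then show "translate T \<one>\<^bsub>T\<^esub> f = f"
      by (auto simp: translate_def fun_eq_iff extensional_def)
  next
    fix s t f assume "s \<in> carrier T" "t \<in> carrier T"
    then show "translate T (s \<otimes>\<^bsub>T\<^esub> t) f = translate T s (translate T t f)"
      by (auto simp: translate_def fun_eq_iff T.inv_mult_group T.m_assoc)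
  next
    fix s f g assume "s \<in> carrier T"
    then show "translate T s (f \<otimes>\<^bsub>sum_group (carrier T) (\<lambda>_. C)\<^esub> g) =
        translate T s f \<otimes>\<^bsub>sum_group (carrier T) (\<lambda>_. C)\<^esub> translate T s g"
      by (auto simp: translate_def fun_eq_iff)
  qed (simp_all add: translate_in_carrier C T)
qed

lemma PLo_carrier_iff:
  "f \<in> PLo_carrier \<longleftrightarrow> f \<in> Bij {0..1} \<and> continuous_on {0..1} f \<and> strict_mono_on {0..1} f \<and>
    finitely_piecewise_linear_on {0..1} f"
proof -
  have "(\<exists>g. homeomorphism {0..1} {0..1} f g) \<longleftrightarrow> continuous_on {0..1} f" if "f \<in> Bij {0..1}"
    using that homeomorphism_compact[of "{0..1::real}" f "{0..1}"]
    by (auto simp: Bij_def bij_betw_def homeomorphism_def)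
  then show ?thesis by (auto simp: PLo_carrier_def)
qed

lemma id_PLo_carrier: "(\<lambda>x\<in>{0..1}. x) \<in> PLo_carrier"
proof -
  have "finitely_piecewise_linear_on {0..1} (\<lambda>x\<in>{0..1}. x)"
    unfolding finitely_piecewise_linear_on_def
    by (rule exI[of _ "{}"]) (simp, intro allI impI exI[of _ 1] exI[of _ 0], auto)
  moreover have "continuous_on {0..1} (\<lambda>x\<in>{0..1::real}. x)"
    by (subst continuous_on_cong[OF refl, of _ _ "\<lambda>x. x"]) simp_all
  ultimately show ?thesis
    by (auto simp: PLo_carrier_iff id_Bij strict_mono_on_def)
qed

lemma PLo_image_interval:
  assumes f: "f \<in> PLo_carrier" and ab: "{a<..<b} \<subseteq> {0..1}" "a < b"
  shows "0 \<le> a" "b \<le> 1" "f ` {a<..<b} = {f a<..<f b}" "f a \<in> {0..1}" "f b \<in> {0..1}"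
proof -
  have "{a..b} \<subseteq> {0..1}"
    using closure_mono[OF ab(1)] ab(2) by simp
  then show a: "0 \<le> a" and b: "b \<le> 1" using ab(2) by auto
  have B: "bij_betw f {0..1} {0..1}" and m: "strict_mono_on {0..1} f"
    using f by (auto simp: PLo_carrier_iff Bij_def)
  show fa: "f a \<in> {0..1}" and fb: "f b \<in> {0..1}"
    using bij_betw_apply[OF B, of a] bij_betw_apply[OF B, of b] a b ab(2) by simp_all
  have less: "f x < f y \<longleftrightarrow> x < y" if "x \<in> {0..1}" "y \<in> {0..1}" for x y
    using strict_mono_on_less[OF m] that by blast
  show "f ` {a<..<b} = {f a<..<f b}"
  proof
    show "f ` {a<..<b} \<subseteq> {f a<..<f b}" using less a b by auto
    show "{f a<..<f b} \<subseteq> f ` {a<..<b}"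
    proof
      fix y assume y: "y \<in> {f a<..<f b}"
      then have "y \<in> {0..1}" using fa fb by auto
      then obtain x where "x \<in> {0..1}" "y = f x"
        using bij_betw_imp_surj_on[OF B] by blast
      then show "y \<in> f ` {a<..<b}" using y less a b ab(2) by auto
    qed
  qed
qed

lemma compose_PLo_carrier:
  assumes f: "f \<in> PLo_carrier" and g: "g \<in> PLo_carrier"
  shows "compose {0..1} f g \<in> PLo_carrier"
proof -
  have Bf: "f \<in> Bij {0..1}" "continuous_on {0..1} f" "strict_mono_on {0..1} f"
    and Bg: "g \<in> Bij {0..1}" "continuous_on {0..1} g" "strict_mono_on {0..1} g"
    using f g by (auto simp: PLo_carrier_iff)
  have gim: "g ` {0..1} = {0..1}" and ginj: "inj_on g {0..1}"
    using Bg by (auto simp: Bij_def bij_betw_def)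
  obtain F where F: "finite F"
    "\<And>a b. {a<..<b} \<subseteq> {0..1} - F \<Longrightarrow> \<exists>m c. \<forall>x\<in>{a<..<b}. f x = m * x + c"
    using f by (auto simp: PLo_carrier_iff finitely_piecewise_linear_on_def)
  obtain G where G: "finite G"
    "\<And>a b. {a<..<b} \<subseteq> {0..1} - G \<Longrightarrow> \<exists>m c. \<forall>x\<in>{a<..<b}. g x = m * x + c"
    using g by (auto simp: PLo_carrier_iff finitely_piecewise_linear_on_def)
  let ?B = "G \<union> (g -` F \<inter> {0..1})"
  have "finite ?B" using F(1) G(1) ginj by (simp add: finite_vimage_IntI)
  moreover have "\<exists>m c. \<forall>x\<in>{a<..<b}. compose {0..1} f g x = m * x + c"
    if ab: "{a<..<b} \<subseteq> {0..1} - ?B" for a b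
  proof (cases "a < b")
    case True
    have sub: "{a<..<b} \<subseteq> {0..1}" using ab by blast
    note im = PLo_image_interval[OF g sub True]
    have "{g a<..<g b} \<subseteq> {0..1} - F"
      using ab sub gim unfolding im(3)[symmetric] by fast
    then obtain m c where mc: "\<forall>x\<in>{g a<..<g b}. f x = m * x + c" using F(2) by blast
    obtain m' c' where mc': "\<forall>x\<in>{a<..<b}. g x = m' * x + c'" using G(2)[of a b] ab by blast
    have "\<forall>x\<in>{a<..<b}. compose {0..1} f g x = (m * m') * x + (m * c' + c)"
    proof
      fix x assume x: "x \<in> {a<..<b}"
      then have "g x \<in> {g a<..<g b}" using im(3) by blast
      then have "f (g x) = m * (m' * x + c') + c" using mc mc' x by metis
      then show "compose {0..1} f g x = (m * m') * x + (m * c' + c)"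
        using x sub by (auto simp: compose_def algebra_simps)
    qed
    then show ?thesis by blast
  qed auto
  ultimately have "finitely_piecewise_linear_on {0..1} (compose {0..1} f g)"
    unfolding finitely_piecewise_linear_on_def by blast
  moreover have "continuous_on {0..1} (compose {0..1} f g)"
    using continuous_on_compose2[OF Bf(2) Bg(2)] gim
    by (subst continuous_on_cong[OF refl, of _ _ "\<lambda>x. f (g x)"]) (simp_all add: compose_def)
  moreover have "strict_mono_on {0..1} (compose {0..1} f g)"
  proof (rule strict_mono_onI)
    fix x y :: real assume xy: "x \<in> {0..1}" "y \<in> {0..1}" "x < y"
    then have "g x \<in> {0..1}" "g y \<in> {0..1}" "g x < g y"
      using gim strict_mono_onD[OF Bg(3) xy] by blast+
    then show "compose {0..1} f g x < compose {0..1} f g y"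
      using xy Bf(3) by (simp add: compose_def strict_mono_onD)
  qed
  ultimately show ?thesis
    using compose_Bij[OF Bf(1) Bg(1)] by (simp add: PLo_carrier_iff)
qed

lemma inv_PLo_carrier:
  assumes f: "f \<in> PLo_carrier"
  shows "(\<lambda>x\<in>{0..1}. inv_into {0..1} f x) \<in> PLo_carrier"
proof -
  let ?g = "\<lambda>x\<in>{0..1}. inv_into {0..1} f x"
  have Bf: "f \<in> Bij {0..1}" "continuous_on {0..1} f" "strict_mono_on {0..1} f"
    using f by (auto simp: PLo_carrier_iff)
  have im: "f ` {0..1} = {0..1}" and inj: "inj_on f {0..1}"
    using Bf by (auto simp: Bij_def bij_betw_def)
  have g_in: "?g x \<in> {0..1}" and fg: "f (?g x) = x" if "x \<in> {0..1}" for x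
    using that im inv_into_into[of x f "{0..1}"] f_inv_into_f[of x f "{0..1}"] by auto
  have gf: "?g (f x) = x" if "x \<in> {0..1}" for x
    using that im inj imageI[OF that, of f] by (simp add: inv_into_f_f)
  have less: "f x < f y \<longleftrightarrow> x < y" if "x \<in> {0..1}" "y \<in> {0..1}" for x y
    using strict_mono_on_less[OF Bf(3)] that by blast
  have mono: "strict_mono_on {0..1} ?g"
  proof (rule strict_mono_onI)
    fix r s :: real assume "r \<in> {0..1}" "s \<in> {0..1}" "r < s"
    then show "?g r < ?g s" using less[OF g_in g_in] fg by metis
  qed
  have cont: "continuous_on {0..1} ?g"
    using continuous_on_inv[OF Bf(2), of ?g] gf im by simp
  obtain F where F: "finite F"
    "\<And>a b. {a<..<b} \<subseteq> {0..1} - F \<Longrightarrow> \<exists>m c. \<forall>x\<in>{a<..<b}. f x = m * x + c"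
    using f by (auto simp: PLo_carrier_iff finitely_piecewise_linear_on_def)
  have "\<exists>m c. \<forall>x\<in>{a<..<b}. ?g x = m * x + c" if ab: "{a<..<b} \<subseteq> {0..1} - f ` F" for a b
  proof (cases "a < b")
    case True
    have "{a..b} \<subseteq> {0..1}"
      using closure_mono[of "{a<..<b}" "{0..1}"] True ab by auto
    then have a: "a \<in> {0..1}" and b: "b \<in> {0..1}" using True by auto
    define p q where "p = ?g a" and "q = ?g b"
    have pq: "p \<in> {0..1}" "q \<in> {0..1}" "f p = a" "f q = b"
      using g_in[OF a] g_in[OF b] fg[OF a] fg[OF b] by (auto simp: p_def q_def)
    have "p < q" using less[OF pq(1,2)] pq True by simp
    have fpq: "f ` {p<..<q} = {a<..<b}"
    proof -
      have "{p<..<q} \<subseteq> {0..1}" using pq(1,2) by auto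
      from PLo_image_interval(3)[OF f this \<open>p < q\<close>] show ?thesis using pq by simp
    qed
    have "{p<..<q} \<subseteq> {0..1} - F"
      using fpq ab pq by fastforce
    then obtain m c where mc: "\<forall>x\<in>{p<..<q}. f x = m * x + c" using F(2) by blast
    have "m \<noteq> 0"
    proof
      assume "m = 0"
      then have "f ` {p<..<q} \<subseteq> {c}" using mc by auto
      then have "{a<..<b} \<subseteq> {c}" using fpq by simp
      then have "finite {a<..<b}" using finite_subset by blast
      then show False using True infinite_Ioo by blast
    qed
    have "\<forall>y\<in>{a<..<b}. ?g y = (1 / m) * y + (- c / m)"
    proof
      fix y assume "y \<in> {a<..<b}"
      then obtain x where x: "x \<in> {p<..<q}" "y = f x" using fpq by blast
      then have "?g y = x" using gf[of x] pq by auto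
      moreover have "y = m * x + c" using x mc by blast
      ultimately show "?g y = (1 / m) * y + (- c / m)" using \<open>m \<noteq> 0\<close> by (simp add: field_simps)
    qed
    then show ?thesis by blast
  qed auto
  then have "finitely_piecewise_linear_on {0..1} ?g"
    unfolding finitely_piecewise_linear_on_def using F(1) by blast
  then show ?thesis
    using restrict_inv_into_Bij[OF Bf(1)] mono cont by (simp add: PLo_carrier_iff)
qed

lemma PLo_carrier_subset_Bij: "PLo_carrier \<subseteq> Bij {0..1}"
  by (auto simp: PLo_carrier_def)

lemma group_PLo: "group PLo"
proof (rule groupI)
  fix f assume "f \<in> carrier PLo"
  then have f: "f \<in> PLo_carrier" by (simp add: PLo_def)
  show "\<exists>g\<in>carrier PLo. g \<otimes>\<^bsub>PLo\<^esub> f = \<one>\<^bsub>PLo\<^esub>"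
    using inv_PLo_carrier[OF f] f PLo_carrier_subset_Bij Bij_compose_restrict_eq[of f "{0..1}"]
    by (intro bexI[of _ "\<lambda>x\<in>{0..1}. inv_into {0..1} f x"])
       (auto simp: PLo_def BijGroup_def subset_iff)
qed (use PLo_carrier_subset_Bij in \<open>auto simp: PLo_def BijGroup_def subset_iff compose_PLo_carrier
      id_PLo_carrier compose_Bij id_Bij Bij_imp_funcset Bij_imp_extensional compose_assoc[symmetric]\<close>)

end

theory Submission
  imports Defs
begin

text \<open>Let \<open>\<tau>\<close> be the action of \<open>\<int>\<^sup>2\<close> and \<open>\<nu>\<close> that of the base group, whose elements
  are finitely supported functions \<open>f\<close>.  Commuting piecewise linear homeomorphisms that both move
  \<open>x\<close> have the same left end of their orbital at \<open>x\<close>, and one of them is the identity on the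
  orbital of the other as soon as it is the identity near its left end.  Hence, if the left end of
  the orbital of \<open>\<nu> f\<close> at \<open>x\<close> is fixed by \<open>\<tau> t\<close>, then \<open>f\<close> and its translate by \<open>t\<close> act equally at \<open>x\<close>:
  conjugation does not change the slope at the fixed end.  In particular this is so if \<open>\<tau> t x = x\<close>.

  Now consider one of the finitely many orbitals of \<open>\<int>\<^sup>2\<close>, with left end \<open>p\<close>.  If the action on it is not
  faithful, some \<open>t \<noteq> 0\<close> fixes all its points.  If it is faithful, the slopes at \<open>p\<close> form a
  dense group, so an orbital of \<open>\<nu> f\<close> with left end inside it, pushed close to \<open>p\<close>, would
  properly overlap a slightly moved copy of itself, although the two homeomorphisms commute.  Either way
  there is \<open>t \<noteq> 0\<close> such that \<open>f\<close> minus its translate by \<open>t\<close> acts trivially on this orbital.  As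
  \<open>\<int>[\<int>\<^sup>2]\<close> has no zero divisors, repeating this for all orbitals gives a nonzero element
  of the base group that acts trivially everywhere.\<close>

section \<open>Piecewise linear homeomorphisms of the line and left ends of orbitals\<close>

text \<open>These model elements of PL_o(I) extended by the identity. One-sided affine germs at
  every point replace a finite list of breaks; by compactness of I this amounts to the same.\<close>

definition pl_homeo :: "(real \<Rightarrow> real) \<Rightarrow> bool"
  where "pl_homeo f \<longleftrightarrow> strict_mono f \<and> surj f \<and> (\<forall>x. x \<notin> {0<..<1} \<longrightarrow> f x = x) \<and>
    (\<forall>z. \<exists>m. \<forall>\<^sub>F x in at_right z. f x = f z + m * (x - z)) \<and>
    (\<forall>z. \<exists>m. \<forall>\<^sub>F x in at_left z. f x = f z + m * (x - z))"

text \<open>For homeomorphisms in \<open>S\<close>, the orbital of x is the component of x in the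
  complement of the common fixed point set, and u is its left end. As a relation it also records
  that x is moved.\<close>

definition left_end :: "(real \<Rightarrow> real) set \<Rightarrow> real \<Rightarrow> real \<Rightarrow> bool"
  where "left_end S u x \<longleftrightarrow> u < x \<and> (\<forall>f\<in>S. f u = u) \<and> (\<forall>y\<in>{u<..x}. \<exists>f\<in>S. f y \<noteq> y)"

lemma pl_homeo_less_iff: "pl_homeo f \<Longrightarrow> f x < f y \<longleftrightarrow> x < y"
  by (simp add: pl_homeo_def strict_mono_less)

lemma pl_homeo_le_iff: "pl_homeo f \<Longrightarrow> f x \<le> f y \<longleftrightarrow> x \<le> y"
  by (simp add: pl_homeo_def strict_mono_less_eq)

lemma pl_homeo_eq_iff: "pl_homeo f \<Longrightarrow> f x = f y \<longleftrightarrow> x = y"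
  by (simp add: pl_homeo_def strict_mono_eq)

lemma pl_homeo_surjE:
  assumes "pl_homeo f" obtains x where "f x = y"
  using assms unfolding pl_homeo_def by (metis surjD)

lemma pl_homeo_fixed_germ:
  assumes f: "pl_homeo f" and u: "f u = u"
  obtains m where "0 < m" "\<forall>\<^sub>F x in at_right u. f x = u + m * (x - u)"
proof -
  obtain m where m: "\<forall>\<^sub>F x in at_right u. f x = u + m * (x - u)"
    using f u unfolding pl_homeo_def by metis
  have "\<forall>\<^sub>F x in at_right u. u < x" by (simp add: eventually_at_right_less)
  with m have "\<forall>\<^sub>F x in at_right u. u < x \<and> f x = u + m * (x - u)" by eventually_elim simp
  then obtain x where "u < x" "f x = u + m * (x - u)"
    using eventually_happens' trivial_limit_at_right_real by blast
  moreover have "u < f x" using pl_homeo_less_iff[OF f, of u x] u \<open>u < x\<close> by simp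
  ultimately have "0 < m" by (simp add: zero_less_mult_iff)
  with m that show thesis by blast
qed

lemma left_end_exists:
  assumes S: "\<And>f. f \<in> S \<Longrightarrow> pl_homeo f" and x: "f0 \<in> S" "f0 x \<noteq> x"
  obtains u where "left_end S u x"
proof -
  \<comment> \<open>The left end is the largest common fixed point below x. That the supremum is
    fixed follows from order and surjectivity, without an appeal to continuity.\<close>
  define F where "F = {y. y \<le> x \<and> (\<forall>f\<in>S. f y = y)}"
  define u where "u = Sup F"
  have "0 < x" using S[OF x(1)] x(2) by (auto simp: pl_homeo_def not_le)
  then have F0: "0 \<in> F" using S by (auto simp: F_def pl_homeo_def)
  have bdd: "bdd_above F" unfolding F_def by (rule bdd_aboveI[of _ x]) auto
  have up: "y \<le> u" if "y \<in> F" for y unfolding u_def using bdd that by (rule cSup_upper[rotated])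
  have ux: "u \<le> x" unfolding u_def using F0 by (intro cSup_least) (auto simp: F_def)
  have near: "\<exists>y\<in>F. z < y \<and> y \<le> u" if "z < u" for z
    using that F0 bdd less_cSup_iff[of F z] up unfolding u_def by auto
  have fix_u: "f u = u" if f: "f \<in> S" for f
  proof (rule ccontr)
    assume "f u \<noteq> u"
    then consider "f u < u" | "u < f u" by linarith
    then show False
    proof cases
      case 1
      then obtain y where "y \<in> F" "f u < y" "y \<le> u" using near by blast
      then show False using f pl_homeo_less_iff[OF S[OF f], of u y] by (auto simp: F_def)
    next
      case 2
      obtain z where z: "f z = u" using S[OF f] pl_homeo_surjE by blast
      then have "z < u" using 2 pl_homeo_less_iff[OF S[OF f], of z u] by simp
      then obtain y where "y \<in> F" "z < y" "y \<le> u" using near by blast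
      then show False using f z pl_homeo_less_iff[OF S[OF f], of z y] by (auto simp: F_def)
    qed
  qed
  have "u \<noteq> x" using fix_u[OF x(1)] x(2) by auto
  then have "left_end S u x"
    unfolding left_end_def using ux fix_u up by (force simp: F_def)
  then show thesis by (rule that)
qed

lemma left_end_unique: "left_end S u x \<Longrightarrow> left_end S w x \<Longrightarrow> u = w"
  unfolding left_end_def by (meson greaterThanAtMost_iff less_imp_le linorder_neqE_linordered_idom)

lemma left_end_mono: "left_end S u x \<Longrightarrow> y \<in> {u<..x} \<Longrightarrow> left_end S u y"
  unfolding left_end_def by auto

lemma left_end_conjugate:
  assumes t: "pl_homeo t" and u: "left_end {g} u x" and h: "\<And>y. h (t y) = t (g y)"
  shows "left_end {h} (t u) (t x)"
proof -
  have "h y \<noteq> y" if y: "t u < y" "y \<le> t x" for y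
  proof -
    obtain z where z: "t z = y" using t pl_homeo_surjE by blast
    then have "z \<in> {u<..x}" using y pl_homeo_less_iff[OF t, of u z] pl_homeo_le_iff[OF t, of z x] by simp
    then show ?thesis using u h[of z] z pl_homeo_eq_iff[OF t, of "g z" z] by (auto simp: left_end_def)
  qed
  then show ?thesis using u h[of u] pl_homeo_less_iff[OF t] by (auto simp: left_end_def)
qed

section \<open>Commuting homeomorphisms\<close>

text \<open>The infimum of \<open>Q\<close> in (w, x] cannot lie above w: it would be moved by h,
  and then h or its inverse would carry points of \<open>Q\<close> near it to points of
  \<open>Q\<close> below it, still above w.\<close>

lemma invariant_accumulates_at_left_end:
  assumes h: "pl_homeo h" and w: "left_end {h} w x" and x: "x \<in> Q"
    and Q: "\<And>q. h q \<in> Q \<longleftrightarrow> q \<in> Q" and "w < b"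
  shows "\<exists>q\<in>Q. w < q \<and> q \<le> x \<and> q < b"
proof -
  define R where "R = Q \<inter> {w<..x}"
  define i where "i = Inf R"
  have wx: "w < x" "h w = w" using w by (auto simp: left_end_def)
  then have xR: "x \<in> R" using x by (simp add: R_def)
  have bdd: "bdd_below R" unfolding R_def by (rule bdd_belowI[of _ w]) auto
  have lower: "i \<le> q" if "q \<in> R" for q unfolding i_def using that bdd by (rule cInf_lower)
  have near: "\<exists>q\<in>R. q < z" if "i < z" for z
    using that xR bdd cInf_less_iff[of R z] unfolding i_def by auto
  have "i \<le> w"
  proof (rule ccontr)
    assume "\<not> i \<le> w"
    then have i: "w < i" "i \<le> x" using lower[OF xR] by auto
    then have "h i \<noteq> i" using w by (auto simp: left_end_def)
    then consider "h i < i" | "i < h i" by linarith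
    then show False
    proof cases
      case 1
      obtain j where j: "h j = i" using h pl_homeo_surjE by blast
      then have "i < j" using 1 pl_homeo_less_iff[OF h, of i j] by simp
      then obtain q where q: "q \<in> R" "q < j" using near by blast
      then have "h q < i" "w < h q" 
        using j wx pl_homeo_less_iff[OF h, of q j] pl_homeo_less_iff[OF h, of w q] by (auto simp: R_def)
      then have "h q \<in> R" using q Q i by (auto simp: R_def)
      then show False using lower \<open>h q < i\<close> by fastforce
    next
      case 2
      then obtain q where q: "q \<in> R" "q < h i" using near by blast
      obtain z where z: "h z = q" using h pl_homeo_surjE by blast
      have "z < i" "w < z"
        using z q wx pl_homeo_less_iff[OF h, of z i] pl_homeo_less_iff[OF h, of w z] by (auto simp: R_def)
      then have "z \<in> R" using q Q[of z] i z by (auto simp: R_def)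
      then show False using lower \<open>z < i\<close> by fastforce
    qed
  qed
  then show ?thesis using near[of b] \<open>w < b\<close> by (auto simp: R_def)
qed

text \<open>The set of points moved by g is invariant under h. If it contained x, it would
  accumulate at w, where g is the identity.\<close>

lemma commuting_eq_id:
  assumes h: "pl_homeo h" and comm: "\<And>y. g (h y) = h (g y)"
    and w: "left_end {h} w x" and germ: "\<forall>\<^sub>F y in at_right w. g y = y"
  shows "g x = x"
proof (rule ccontr)
  assume "g x \<noteq> x"
  obtain b where b: "w < b" "\<And>y. w < y \<Longrightarrow> y < b \<Longrightarrow> g y = y"
    using germ unfolding eventually_at_right_field by blast
  have "\<exists>q\<in>{y. g y \<noteq> y}. w < q \<and> q \<le> x \<and> q < b"
    using \<open>g x \<noteq> x\<close> comm pl_homeo_eq_iff[OF h] b(1)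
    by (intro invariant_accumulates_at_left_end[OF h w]) auto
  then show False using b by blast
qed

text \<open>If w < u, then u is a fixed point of g inside the orbital of h, so fixed points of g
  accumulate at w. An affine germ with two fixed points is the identity, hence g fixes x, a
  contradiction.\<close>

lemma commuting_left_end_le:
  assumes g: "pl_homeo g" and h: "pl_homeo h" and comm: "\<And>y. g (h y) = h (g y)"
    and u: "left_end {g} u x" and w: "left_end {h} w x"
  shows "u \<le> w"
proof (rule ccontr)
  assume "\<not> u \<le> w"
  then have wu: "w < u" "u \<le> x" "g u = u" using u by (auto simp: left_end_def)
  then have hu: "left_end {h} w u" using w left_end_mono by auto
  obtain m where "\<forall>\<^sub>F y in at_right w. g y = g w + m * (y - w)"
    using g unfolding pl_homeo_def by metis
  then obtain b where b: "w < b" "\<And>y. w < y \<Longrightarrow> y < b \<Longrightarrow> g y = g w + m * (y - w)"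
    unfolding eventually_at_right_field by blast
  have acc: "\<exists>q. g q = q \<and> w < q \<and> q < c" if "w < c" for c
  proof -
    have "\<exists>q\<in>{y. g y = y}. w < q \<and> q \<le> u \<and> q < c"
      using wu comm pl_homeo_eq_iff[OF h] that
      by (intro invariant_accumulates_at_left_end[OF h hu]) auto
    then show ?thesis by blast
  qed
  obtain q where q: "g q = q" "w < q" "q < b" using acc b(1) by blast
  obtain r where r: "g r = r" "w < r" "r < q" using acc q(2) by blast
  have "g w + m * (q - w) = q" "g w + m * (r - w) = r" using b(2) q r by force+
  then have "(m - 1) * (q - r) = 0" by (simp add: algebra_simps)
  then have "m = 1" using r by simp
  then have "g w = w" using \<open>g w + m * (q - w) = q\<close> by simp
  then have "\<forall>\<^sub>F y in at_right w. g y = y"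
    unfolding eventually_at_right_field using b \<open>m = 1\<close> by auto
  then have "g x = x" using commuting_eq_id[of h g] h comm w by blast
  then show False using u by (auto simp: left_end_def)
qed

lemma commuting_left_end_eq:
  assumes "pl_homeo g" "pl_homeo h" "\<And>y. g (h y) = h (g y)" "left_end {g} u x" "left_end {h} w x"
  shows "u = w"
proof (rule antisym)
  show "u \<le> w" by (rule commuting_left_end_le[of g h]) (use assms in auto)
  show "w \<le> u" by (rule commuting_left_end_le[of h g]) (use assms in auto)
qed

text \<open>If h fixes x, it maps the orbital of g at x to itself, since it conjugates g to itself.
  If h moves x, both maps have the same left end at x.\<close>

lemma commuting_fixes_left_end:
  assumes g: "pl_homeo g" and h: "pl_homeo h" and comm: "\<And>y. g (h y) = h (g y)"
    and u: "left_end {g} u x"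
  shows "h u = u"
proof (cases "h x = x")
  case True
  have "left_end {g} (h u) (h x)" using left_end_conjugate[OF h u] comm by simp
  then show ?thesis using True u left_end_unique by metis
next
  case False
  then obtain w where w: "left_end {h} w x" using h by (auto intro: left_end_exists[of "{h}"])
  then show ?thesis using commuting_left_end_eq[OF g h comm u w] by (simp add: left_end_def)
qed

text \<open>Just to the right of a left end every point is moved, so an affine piece contains at
  most one: two fixed points would make it the identity. Hence left ends accumulate nowhere, and
  they lie in the compact interval I.\<close>

lemma finite_left_ends:
  assumes f: "pl_homeo f"
  shows "finite {p. \<exists>x. left_end {f} p x}"
proof -
  define P where "P = {p. \<exists>x. left_end {f} p x}"
  have one: "p = q"
    if aff: "\<And>y. l < y \<Longrightarrow> y < r \<Longrightarrow> f y = c + m * (y - z)"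
      and pq: "p \<in> P" "q \<in> P" "l < p" "p < r" "l < q" "q < r" for l r c m z p q
  proof -
    have False if pq: "p \<in> P" "q \<in> P" "l < p" "q < r" "p < q" for p q
    proof -
      have "f p = p" "f q = q" using pq by (auto simp: P_def left_end_def)
      then have e: "c + m * (p - z) = p" "c + m * (q - z) = q" using aff pq by force+
      then have "(m - 1) * (q - p) = 0" by (simp add: algebra_simps)
      then have "m = 1" using pq by simp
      obtain x where x: "left_end {f} p x" using pq by (auto simp: P_def)
      let ?y = "min x ((p + q) / 2)"
      have "p < ?y" using x pq by (auto simp: left_end_def)
      have "?y < q" using pq by (auto simp: min_def)
      then have "f ?y = ?y" using aff[of ?y] e \<open>p < ?y\<close> pq \<open>m = 1\<close> by simp
      then show False using x \<open>p < ?y\<close> by (auto simp: left_end_def)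
    qed
    then show ?thesis using pq by (metis linorder_neqE_linordered_idom)
  qed
  have "\<not> z islimpt P" for z
  proof -
    have "\<forall>\<^sub>F y in at_right z. y \<notin> P"
    proof -
      obtain m b where b: "z < b" "\<And>y. z < y \<Longrightarrow> y < b \<Longrightarrow> f y = f z + m * (y - z)"
        using f unfolding pl_homeo_def eventually_at_right_field by metis
      show ?thesis
      proof (cases "\<exists>p\<in>P. z < p \<and> p < b")
        case True
        then obtain p where p: "p \<in> P" "z < p" "p < b" by blast
        then have "\<forall>y>z. y < p \<longrightarrow> y \<notin> P" using one[OF b(2)] by fastforce
        then show ?thesis unfolding eventually_at_right_field using p by blast
      qed (use b(1) in \<open>auto simp: eventually_at_right_field\<close>)
    qed
    moreover have "\<forall>\<^sub>F y in at_left z. y \<notin> P"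
    proof -
      obtain m b where b: "b < z" "\<And>y. b < y \<Longrightarrow> y < z \<Longrightarrow> f y = f z + m * (y - z)"
        using f unfolding pl_homeo_def eventually_at_left_field by metis
      show ?thesis
      proof (cases "\<exists>p\<in>P. b < p \<and> p < z")
        case True
        then obtain p where p: "p \<in> P" "b < p" "p < z" by blast
        then have "\<forall>y>p. y < z \<longrightarrow> y \<notin> P" using one[OF b(2)] by fastforce
        then show ?thesis unfolding eventually_at_left_field using p by blast
      qed (use b(1) in \<open>auto simp: eventually_at_left_field\<close>)
    qed
    ultimately show ?thesis by (simp add: islimpt_iff_eventually eventually_at_split)
  qed
  then have "finite ({0..1} \<inter> P)" by (intro finite_not_islimpt_in_compact) auto
  moreover have "P \<subseteq> {0..1}"
  proof
    fix p assume "p \<in> P"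
    then obtain x where x: "left_end {f} p x" by (auto simp: P_def)
    have out: "f y = y" if "y \<le> 0 \<or> 1 \<le> y" for y using f that by (auto simp: pl_homeo_def)
    \<comment> \<open>If p were below \<open>min x 0\<close>, this point would lie in (p, x] and be
      moved, although it lies outside (0, 1).\<close>
    have "0 < min x 0 \<or> min x 0 \<le> p"
      using x out[of "min x 0"] unfolding left_end_def by (metis greaterThanAtMost_iff insertI1 linorder_not_le min.cobounded1 min.cobounded2 singletonD)
    moreover have "x < 1" using x out[of x] by (auto simp: left_end_def not_le[symmetric])
    moreover have "0 < x" using x out[of x] by (auto simp: left_end_def not_le[symmetric])
    ultimately show "p \<in> {0..1}" using x by (auto simp: left_end_def)
  qed
  ultimately show ?thesis unfolding P_def by (simp add: Int_absorb1)
qed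

section \<open>Additive maps from Z^2 to the reals\<close>

lemma additive_int_mult:
  fixes L :: "int \<times> int \<Rightarrow> real"
  assumes add: "\<And>s t. L (s + t) = L s + L t"
  shows "L (k * i, k * j) = k * L (i, j)"
proof (induction k rule: int_induct[of _ 0])
  case base
  show ?case using add[of 0 0] by (simp add: zero_prod_def)
next
  case (step1 k)
  then show ?case using add[of "(k * i, k * j)" "(i, j)"] by (simp add: algebra_simps)
next
  case (step2 k)
  then show ?case using add[of "((k - 1) * i, (k - 1) * j)" "(i, j)"] by (simp add: algebra_simps)
qed

text \<open>Dirichlet approximation of \<open>\<beta> / \<alpha>\<close> by h / k makes L (- h, k) =
  k \<beta> - h \<alpha> small, and injectivity makes it nonzero. One of the two signs is
  negative.\<close>

lemma additive_injective_small_value: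
  fixes L :: "int \<times> int \<Rightarrow> real"
  assumes add: "\<And>s t. L (s + t) = L s + L t" and inj: "\<And>t. L t = 0 \<Longrightarrow> t = 0" and "0 < e"
  shows "\<exists>t. - e < L t \<and> L t < 0"
proof -
  define \<alpha> \<beta> where "\<alpha> = L (1, 0)" and "\<beta> = L (0, 1)"
  have L: "L (m, n) = m * \<alpha> + n * \<beta>" for m n
    using add[of "(m, 0)" "(0, n)"] additive_int_mult[OF add, of m 1 0] additive_int_mult[OF add, of n 0 1]
    by (simp add: \<alpha>_def \<beta>_def)
  have "\<alpha> \<noteq> 0" unfolding \<alpha>_def using inj[of "(1, 0)"] by (auto simp: zero_prod_def)
  obtain N :: nat where N: "\<bar>\<alpha>\<bar> / e < N" using reals_Archimedean2 by blast
  have "0 < \<bar>\<alpha>\<bar> / e" using \<open>\<alpha> \<noteq> 0\<close> \<open>0 < e\<close> by simp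
  then have "0 < N" using N by (metis of_nat_0_less_iff order_less_trans)
  obtain h k where hk: "0 < k" "\<bar>of_int k * (\<beta> / \<alpha>) - of_int h\<bar> < 1 / N"
    using Dirichlet_approx[OF \<open>0 < N\<close>, of "\<beta> / \<alpha>"] by blast
  have "L (- h, k) = \<alpha> * (of_int k * (\<beta> / \<alpha>) - of_int h)"
    using \<open>\<alpha> \<noteq> 0\<close> by (simp add: L field_simps)
  then have "\<bar>L (- h, k)\<bar> = \<bar>\<alpha>\<bar> * \<bar>of_int k * (\<beta> / \<alpha>) - of_int h\<bar>" by (simp add: abs_mult)
  also have "\<dots> < \<bar>\<alpha>\<bar> * (1 / N)" using hk(2) \<open>\<alpha> \<noteq> 0\<close> by (intro mult_strict_left_mono) auto
  also have "\<dots> < e" using N \<open>0 < N\<close> \<open>0 < e\<close> by (simp add: field_simps)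
  finally have small: "\<bar>L (- h, k)\<bar> < e" .
  have "L (- h, k) \<noteq> 0" using inj[of "(- h, k)"] hk(1) by (auto simp: zero_prod_def)
  moreover have "L (h, - k) = - L (- h, k)" by (simp add: L)
  ultimately have "(- e < L (- h, k) \<and> L (- h, k) < 0) \<or> (- e < L (h, - k) \<and> L (h, - k) < 0)"
    using small by linarith
  then show ?thesis by blast
qed

section \<open>Finitely supported functions on Z^2\<close>

abbreviation shift :: "int \<times> int \<Rightarrow> (int \<times> int \<Rightarrow> int) \<Rightarrow> int \<times> int \<Rightarrow> int"
  where "shift t f \<equiv> (\<lambda>x. f (x - t))"

abbreviation finsupp :: "(int \<times> int \<Rightarrow> int) \<Rightarrow> bool"
  where "finsupp f \<equiv> finite {x. f x \<noteq> 0}"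

lemma finsupp_shift: "finsupp f \<Longrightarrow> finsupp (shift t f)"
proof -
  assume f: "finsupp f"
  have "{x. f (x - t) \<noteq> 0} \<subseteq> (\<lambda>x. x + t) ` {x. f x \<noteq> 0}"
    by (auto intro!: image_eqI[of _ _ "_ - t"])
  then show ?thesis using f finite_surj by blast
qed

lemma finsupp_diff: "finsupp f \<Longrightarrow> finsupp g \<Longrightarrow> finsupp (\<lambda>x. f x - g x)"
  by (rule finite_subset[of _ "{x. f x \<noteq> 0} \<union> {x. g x \<noteq> 0}"]) auto

text \<open>The form in which the absence of zero divisors is used: 1 - t annihilates no nonzero
  element of Z[Z^2]. A nonzero value at x would recur at the infinitely many points x - n t.\<close>

lemma finsupp_periodic:
  assumes f: "finsupp f" and t: "t \<noteq> 0" and per: "\<And>x. f x = f (x - t)"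
  shows "f x = 0"
proof (rule ccontr)
  assume x: "f x \<noteq> 0"
  define y where "y n = (fst x - int n * fst t, snd x - int n * snd t)" for n
  have "f (y n) \<noteq> 0" for n
  proof (induction n)
    case (Suc n)
    have "y (Suc n) = y n - t" by (simp add: y_def prod_eq_iff algebra_simps)
    then show ?case using Suc per[of "y n"] by simp
  qed (use x in \<open>simp add: y_def\<close>)
  then have "range y \<subseteq> {x. f x \<noteq> 0}" by auto
  then have "finite (range y)" using f by (rule finite_subset)
  moreover have "inj y" using t by (auto simp: y_def inj_def prod_eq_iff)
  ultimately show False using finite_imageD infinite_UNIV_nat by blast
qed

section \<open>Piecewise linear actions of the wreath product\<close>

text \<open>The restrictions of an embedding to the base group and to Z^2, tied together by the
  conjugation relation \<open>\<tau>_\<nu>\<close>.\<close>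

locale wreath_action =
  fixes \<nu> :: "(int \<times> int \<Rightarrow> int) \<Rightarrow> real \<Rightarrow> real" and \<tau> :: "int \<times> int \<Rightarrow> real \<Rightarrow> real"
  assumes pl_\<nu>: "finsupp f \<Longrightarrow> pl_homeo (\<nu> f)"
    and pl_\<tau>: "pl_homeo (\<tau> t)"
    and \<nu>_add: "finsupp f \<Longrightarrow> finsupp g \<Longrightarrow> \<nu> (\<lambda>x. f x + g x) y = \<nu> f (\<nu> g y)"
    and \<tau>_add: "\<tau> (s + t) y = \<tau> s (\<tau> t y)"
    and \<tau>_\<nu>: "finsupp f \<Longrightarrow> \<tau> t (\<nu> f y) = \<nu> (shift t f) (\<tau> t y)"
    and \<nu>_faithful: "finsupp f \<Longrightarrow> (\<And>x. \<nu> f x = x) \<Longrightarrow> f i = 0"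
begin

declare split_paired_All [simp del] split_paired_Ex [simp del]

lemma \<nu>_commute: "finsupp f \<Longrightarrow> finsupp g \<Longrightarrow> \<nu> f (\<nu> g y) = \<nu> g (\<nu> f y)"
  using \<nu>_add[of f g y] \<nu>_add[of g f y] by (simp add: add.commute)

lemma \<tau>_commute: "\<tau> s (\<tau> t y) = \<tau> t (\<tau> s y)"
  by (metis \<tau>_add add.commute)

lemma \<tau>_0: "\<tau> 0 y = y"
  using \<tau>_add[of 0 0 y] pl_homeo_eq_iff[OF pl_\<tau>, of 0] by simp

lemma \<tau>_minus: "\<tau> (- t) (\<tau> t y) = y" "\<tau> t (\<tau> (- t) y) = y"
  by (simp_all add: \<tau>_0 flip: \<tau>_add)

lemma \<nu>_diff_fixes_iff:
  assumes f: "finsupp f" and g: "finsupp g"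
  shows "\<nu> (\<lambda>x. f x - g x) y = y \<longleftrightarrow> \<nu> f y = \<nu> g y"
proof -
  have "\<nu> f y = \<nu> g (\<nu> (\<lambda>x. f x - g x) y)"
    using \<nu>_add[OF g finsupp_diff[OF f g], of y] by simp
  then show ?thesis using pl_homeo_eq_iff[OF pl_\<nu>[OF g]] by simp
qed

lemma left_end_shift:
  "finsupp f \<Longrightarrow> left_end {\<nu> f} u x \<Longrightarrow> left_end {\<nu> (shift t f)} (\<tau> t u) (\<tau> t x)"
  by (rule left_end_conjugate[of "\<tau> t" "\<nu> f"]) (simp_all add: pl_\<tau> \<tau>_\<nu>)

lemma \<nu>_left_end_exists:
  assumes "finsupp f" "\<nu> f x \<noteq> x"
  obtains u where "left_end {\<nu> f} u x"
  using assms pl_\<nu> left_end_exists[of "{\<nu> f}" "\<nu> f" x] by auto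

text \<open>Conjugation by \<open>\<tau> t\<close> preserves the slope at a common fixed point, so \<open>\<nu> f\<close> and its
  conjugate have the same germ at \<open>u\<close>.\<close>

lemma \<nu>_shift_eq_if_left_end_fixed:
  assumes f: "finsupp f" and u: "left_end {\<nu> f} u x" and t: "\<tau> t u = u"
  shows "\<nu> f x = \<nu> (shift t f) x"
proof -
  let ?h = "\<nu> (shift t f)" and ?k = "\<nu> (\<lambda>x. f x - shift t f x)"
  have fs: "finsupp (shift t f)" "finsupp (\<lambda>x. f x - shift t f x)"
    using f finsupp_shift finsupp_diff by auto
  have fu: "\<nu> f u = u" using u by (simp add: left_end_def)
  obtain m where m: "0 < m" "\<forall>\<^sub>F y in at_right u. \<nu> f y = u + m * (y - u)"
    using pl_homeo_fixed_germ[OF pl_\<nu>[OF f] fu] .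
  obtain s where s: "0 < s" "\<forall>\<^sub>F y in at_right u. \<tau> t y = u + s * (y - u)"
    using pl_homeo_fixed_germ[OF pl_\<tau> t] .
  obtain b where b: "u < b" "\<And>y. u < y \<Longrightarrow> y < b \<Longrightarrow> \<nu> f y = u + m * (y - u)"
    using m(2) unfolding eventually_at_right_field by blast
  obtain c where c: "u < c" "\<And>y. u < y \<Longrightarrow> y < c \<Longrightarrow> \<tau> t y = u + s * (y - u)"
    using s(2) unfolding eventually_at_right_field by blast
  \<comment> \<open>Write z = \<open>\<tau> t y\<close>. The bounds place z and y in the linear
    range of \<open>\<nu> f\<close>, and y and \<open>\<nu> f y\<close> in that of
    \<open>\<tau> t\<close>; the two linear maps then commute.\<close>
  have germ: "?h z = \<nu> f z"
    if z: "u < z" "z < b" "z < u + s * (b - u)" "z < u + s * (c - u)" "z < u + s * ((c - u) / m)" for z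
  proof -
    define y where "y = u + (z - u) / s"
    have y: "u < y" "y < b" "y < c" "m * (y - u) < c - u" "z = u + s * (y - u)"
      using z s(1) m(1) by (simp_all add: y_def field_simps)
    have "?h z = \<tau> t (\<nu> f y)" using c(2) y \<tau>_\<nu>[OF f, of t y] by simp
    also have "\<dots> = u + s * (m * (y - u))" using b(2)[of y] c(2)[of "u + m * (y - u)"] y m(1) by simp
    also have "\<dots> = \<nu> f z" using b(2)[OF z(1,2)] y(5) by simp
    finally show ?thesis .
  qed
  have "\<forall>\<^sub>F z in at_right u. ?k z = z"
    unfolding eventually_at_right_field
  proof (intro exI conjI allI impI)
    let ?d = "min (min b (u + s * (b - u))) (min (u + s * (c - u)) (u + s * ((c - u) / m)))"
    show "u < ?d" using b(1) c(1) m(1) s(1) by simp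
    show "?k z = z" if "u < z" "z < ?d" for z
      using germ that by (subst \<nu>_diff_fixes_iff[OF f fs(1)]) simp
  qed
  then have "?k x = x"
    using commuting_eq_id[of "\<nu> f" ?k] pl_\<nu>[OF f] \<nu>_commute[OF fs(2) f] u by blast
  then show ?thesis using \<nu>_diff_fixes_iff[OF f fs(1)] by simp
qed

text \<open>Conjugation by \<open>\<tau> t\<close> sends the left end u at x to the left end
  \<open>\<tau> t u\<close> at the same point x, and the conjugate commutes with
  \<open>\<nu> f\<close>.\<close>

lemma left_end_fixed_if_fixed:
  assumes f: "finsupp f" and u: "left_end {\<nu> f} u x" and x: "\<tau> t x = x"
  shows "\<tau> t u = u"
proof -
  have "left_end {\<nu> (shift t f)} (\<tau> t u) x" using left_end_shift[OF f u, of t] x by simp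
  then show ?thesis
    using commuting_left_end_eq[of "\<nu> f" "\<nu> (shift t f)"] pl_\<nu> f finsupp_shift[OF f] \<nu>_commute u by metis
qed

lemma \<nu>_shift_fixes:
  assumes "finsupp f" "\<tau> t x = x" "\<nu> f x = x"
  shows "\<nu> (shift t f) x = x"
  using assms \<tau>_\<nu>[of f t x] by simp

lemma \<nu>_shift_eq_at_fixed_point:
  assumes f: "finsupp f" and x: "\<tau> t x = x"
  shows "\<nu> f x = \<nu> (shift t f) x"
proof (cases "\<nu> f x = x")
  case True
  then show ?thesis using \<nu>_shift_fixes[OF f x] by simp
next
  case False
  then obtain u where "left_end {\<nu> f} u x" using f \<nu>_left_end_exists by blast
  then show ?thesis using \<nu>_shift_eq_if_left_end_fixed[OF f] left_end_fixed_if_fixed[OF f _ x] by blast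
qed

section \<open>Orbitals of Z^2\<close>

text \<open>The left end of the orbital of \<open>\<tau> s\<close> is fixed by every translation,
  because they all commute. It is therefore also the left end for the whole of Z^2.\<close>

lemma left_end_translation:
  assumes p: "left_end (range \<tau>) p x" and s: "\<tau> s x \<noteq> x"
  shows "left_end {\<tau> s} p x"
proof -
  obtain w where w: "left_end {\<tau> s} w x"
    using s pl_\<tau> left_end_exists[of "{\<tau> s}" "\<tau> s" x] by auto
  have "\<tau> t w = w" for t
    using commuting_fixes_left_end[of "\<tau> s" "\<tau> t"] pl_\<tau> \<tau>_commute w by blast
  then have "left_end (range \<tau>) w x" using w by (auto simp: left_end_def)
  then show ?thesis using left_end_unique[OF p] w by simp
qed

lemma left_end_range_invariant:
  assumes p: "left_end (range \<tau>) p x"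
  shows "left_end (range \<tau>) p (\<tau> t x)"
proof -
  have tp: "\<tau> s p = p" for s using p by (auto simp: left_end_def)
  have "\<exists>s. \<tau> s y \<noteq> y" if y: "p < y" "y \<le> \<tau> t x" for y
  proof -
    have "\<tau> (- t) y \<in> {p<..x}"
      using y pl_homeo_less_iff[OF pl_\<tau>, of "- t" p y] pl_homeo_le_iff[OF pl_\<tau>, of "- t" y "\<tau> t x"]
      by (simp add: tp \<tau>_minus)
    then have "\<exists>s. \<tau> s (\<tau> (- t) y) \<noteq> \<tau> (- t) y" using p by (auto simp: left_end_def)
    then show ?thesis using \<tau>_commute[of _ "- t" y] by metis
  qed
  moreover have "p < \<tau> t x" using p pl_homeo_less_iff[OF pl_\<tau>, of t p x] by (simp add: tp left_end_def)
  ultimately show ?thesis using tp by (auto simp: left_end_def)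
qed


text \<open>If u is moved, it lies to the right of p. Push u and x towards p into a region where
  translations are linear, then apply a slope just below 1: the left end moves, but the two orbitals
  still share a point, against \<open>commuting_left_end_eq\<close>.\<close>

lemma left_end_fixed_on_faithful_orbital:
  assumes f: "finsupp f" and u: "left_end {\<nu> f} u x" and p: "left_end (range \<tau>) p x"
    and faithful: "\<And>t. t \<noteq> 0 \<Longrightarrow> \<exists>y. left_end (range \<tau>) p y \<and> \<tau> t y \<noteq> y"
  shows "\<tau> t u = u"
proof (rule ccontr)
  assume tu: "\<tau> t u \<noteq> u"
  have px: "p < x" and ux: "u < x" and \<tau>p: "\<tau> s p = p" for s
    using p u by (auto simp: left_end_def)
  have "p < u"
  proof (rule ccontr)
    assume "\<not> p < u"
    then consider "u < p" | "u = p" by linarith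
    then show False
    proof cases
      case 1
      \<comment> \<open>Here p would lie in the orbital of \<open>\<nu> f\<close>; as every
        translation fixes p, each would fix u as well.\<close>
      then have "left_end {\<nu> f} u p" using left_end_mono[OF u] px by simp
      then show False using left_end_fixed_if_fixed[OF f _ \<tau>p] tu by blast
    qed (use \<tau>p tu in simp)
  qed
  have "\<exists>m>0. \<forall>\<^sub>F y in at_right p. \<tau> s y = p + m * (y - p)" for s
    using pl_homeo_fixed_germ[OF pl_\<tau> \<tau>p] by metis
  then obtain m where m: "\<And>s. 0 < m s" "\<And>s. \<forall>\<^sub>F y in at_right p. \<tau> s y = p + m s * (y - p)"
    by metis
  have nbh: "\<exists>b>p. \<forall>y. p < y \<and> y < b \<longrightarrow> \<tau> s y = p + m s * (y - p)" for s
    using m(2)[of s] unfolding eventually_at_right_field by auto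
  have m_add: "m (r + s) = m r * m s" for r s
  proof -
    obtain b where b: "p < b" "\<And>y. p < y \<Longrightarrow> y < b \<Longrightarrow> \<tau> (r + s) y = p + m (r + s) * (y - p)"
      using nbh[of "r + s"] by blast
    obtain c where c: "p < c" "\<And>y. p < y \<Longrightarrow> y < c \<Longrightarrow> \<tau> r y = p + m r * (y - p)"
      using nbh[of r] by blast
    obtain d where d: "p < d" "\<And>y. p < y \<Longrightarrow> y < d \<Longrightarrow> \<tau> s y = p + m s * (y - p)"
      using nbh[of s] by blast
    have "p < min (min b d) (p + (c - p) / m s)" using b(1) c(1) d(1) m(1)[of s] by simp
    then obtain y where "p < y" "y < min (min b d) (p + (c - p) / m s)" using dense by blast
    then have y: "p < y" "y < b" "y < d" "y - p < (c - p) / m s" by auto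
    then have "m s * (y - p) < c - p" using m(1)[of s] by (simp add: pos_less_divide_eq mult.commute)
    then have "\<tau> r (\<tau> s y) = p + m r * (m s * (y - p))"
      using c(2)[of "p + m s * (y - p)"] d(2)[of y] y m(1)[of s] by simp
    then have "m (r + s) * (y - p) = m r * (m s * (y - p))"
      using b(2)[of y] y by (simp add: \<tau>_add)
    then show ?thesis using y by simp
  qed
  \<comment> \<open>Slope 1 at p means identity near p, hence at every point of the orbital, against
    faithfulness.\<close>
  have m_inj: "s = 0" if "m s = 1" for s
  proof (rule ccontr)
    assume "s \<noteq> 0"
    then obtain y where y: "left_end (range \<tau>) p y" "\<tau> s y \<noteq> y" using faithful by blast
    have "\<forall>\<^sub>F y in at_right p. \<tau> s y = y" using m(2)[of s] that by simp
    then show False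
      using commuting_eq_id[of "\<tau> s" "\<tau> s"] left_end_translation[OF y] pl_\<tau> y(2) by blast
  qed
  \<comment> \<open>The logarithm of the slope is additive and injective, so slopes come arbitrarily
    close to 1 from below.\<close>
  have small: "\<exists>s. r < m s \<and> m s < 1" if r: "0 < r" "r < 1" for r
  proof -
    have "\<exists>s. - (- ln r) < ln (m s) \<and> ln (m s) < 0"
    proof (rule additive_injective_small_value)
      show "ln (m (s + t)) = ln (m s) + ln (m t)" for s t
        by (simp add: m_add ln_mult_pos m(1))
      show "s = 0" if "ln (m s) = 0" for s using that m(1)[of s] m_inj by simp
      show "0 < - ln r" using r by simp
    qed
    then obtain s where "ln r < ln (m s)" "ln (m s) < 0" by auto
    then show ?thesis using r m(1)[of s] by auto
  qed
  obtain e where e: "0 < m e" "m e < 1" using small[of "1/2"] m(1) by force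
  obtain b where b: "p < b" "\<And>y. p < y \<Longrightarrow> y < b \<Longrightarrow> \<tau> e y = p + m e * (y - p)"
    using nbh[of e] by blast
  \<comment> \<open>The Z^2-orbit of x accumulates at p, so some translate of x enters the range
    where \<open>\<tau> e\<close> is a linear contraction.\<close>
  obtain s0 where s0: "\<tau> s0 x < b"
  proof -
    have "\<exists>s. \<tau> s x \<noteq> x" using p px by (auto simp: left_end_def)
    then obtain s where "\<tau> s x \<noteq> x" by blast
    then have "left_end {\<tau> s} p x" by (rule left_end_translation[OF p])
    moreover have "\<tau> s q \<in> range (\<lambda>r. \<tau> r x) \<longleftrightarrow> q \<in> range (\<lambda>r. \<tau> r x)" for q
    proof
      assume "\<tau> s q \<in> range (\<lambda>r. \<tau> r x)"
      then obtain r where "\<tau> s q = \<tau> r x" by blast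
      then have "q = \<tau> (- s + r) x" using \<tau>_minus(1)[of s q] by (metis \<tau>_add)
      then show "q \<in> range (\<lambda>r. \<tau> r x)" by blast
    next
      assume "q \<in> range (\<lambda>r. \<tau> r x)"
      then show "\<tau> s q \<in> range (\<lambda>r. \<tau> r x)" by (auto simp flip: \<tau>_add)
    qed
    moreover have "x \<in> range (\<lambda>r. \<tau> r x)" using \<tau>_0 by (metis rangeI)
    ultimately have "\<exists>q\<in>range (\<lambda>r. \<tau> r x). p < q \<and> q \<le> x \<and> q < b"
      using b(1) pl_\<tau> by (intro invariant_accumulates_at_left_end)
    then show thesis using that by blast
  qed
  define u0 x0 where "u0 = \<tau> s0 u - p" and "x0 = \<tau> s0 x - p"
  have u0: "0 < u0" "u0 < x0" "x0 < b - p"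
    using \<open>p < u\<close> ux s0 pl_homeo_less_iff[OF pl_\<tau>, of s0 p u] pl_homeo_less_iff[OF pl_\<tau>, of s0 u x]
    by (simp_all add: u0_def x0_def \<tau>p)
  have scaled: "\<exists>s. \<tau> s u = p + m e ^ n * u0 \<and> \<tau> s x = p + m e ^ n * x0" for n
  proof (induction n)
    case 0
    then show ?case by (intro exI[of _ s0]) (simp add: u0_def x0_def)
  next
    case (Suc n)
    then obtain s where s: "\<tau> s u = p + m e ^ n * u0" "\<tau> s x = p + m e ^ n * x0" by blast
    have "m e ^ n * z < b - p" if "0 < z" "z < b - p" for z
      using that e by (intro order.strict_trans1[OF mult_left_le_one_le]) (simp_all add: power_le_one)
    then have "m e ^ n * u0 < b - p" "m e ^ n * x0 < b - p" using u0 by auto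
    then have "\<tau> (e + s) u = p + m e ^ Suc n * u0" "\<tau> (e + s) x = p + m e ^ Suc n * x0"
      using b(2)[of "p + m e ^ n * u0"] b(2)[of "p + m e ^ n * x0"] u0 e(1)
      by (simp_all add: \<tau>_add s)
    then show ?case by blast
  qed
  \<comment> \<open>Contraction towards p preserves the ratio \<open>u0 / x0\<close>, so t can be
    chosen before n, which then depends on the linear range of \<open>\<tau> t\<close>.\<close>
  obtain t where t: "u0 / x0 < m t" "m t < 1" using small[of "u0 / x0"] u0 by auto
  obtain c where c: "p < c" "\<And>y. p < y \<Longrightarrow> y < c \<Longrightarrow> \<tau> t y = p + m t * (y - p)"
    using nbh[of t] by blast
  obtain n where n: "m e ^ n < (c - p) / x0"
    using real_arch_pow_inv[of "(c - p) / x0" "m e"] c(1) u0 e by auto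
  obtain s where s: "\<tau> s u = p + m e ^ n * u0" "\<tau> s x = p + m e ^ n * x0" using scaled by blast
  define u' x' where "u' = \<tau> s u" and "x' = \<tau> s x"
  have k: "0 < m e ^ n" using e by simp
  have "m e ^ n * x0 < c - p" using n u0 by (simp add: pos_less_divide_eq)
  moreover have "m e ^ n * u0 < m e ^ n * x0" using k u0 by simp
  ultimately have "u' < c" "x' < c" unfolding u'_def x'_def s by linarith+
  then have lin: "\<tau> t u' = p + m t * (m e ^ n * u0)" "\<tau> t x' = p + m t * (m e ^ n * x0)"
    using c(2)[of u'] c(2)[of x'] u0 k by (simp_all add: u'_def x'_def s)
  have "m e ^ n * u0 < m t * (m e ^ n * x0)"
    using t(1) u0 k by (simp add: pos_divide_less_eq)
  then have tx: "\<tau> t x' \<in> {u'<..x'}"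
    using t(2) u0 k lin by (simp add: u'_def x'_def s)
  have tu': "\<tau> t u' < u'"
    using t(2) u0 k lin by (simp add: u'_def s)
  \<comment> \<open>Conjugating by \<open>\<tau> s\<close> moves the left end u at x to u' at
    x'.\<close>
  define F where "F = shift s f"
  have F: "finsupp F" unfolding F_def by (rule finsupp_shift[OF f])
  then have F': "finsupp (shift t F)" by (rule finsupp_shift)
  have "left_end {\<nu> F} u' x'" using left_end_shift[OF f u] by (simp add: F_def u'_def x'_def)
  then have ends: "left_end {\<nu> F} u' (\<tau> t x')" "left_end {\<nu> (shift t F)} (\<tau> t u') (\<tau> t x')"
    using left_end_mono tx left_end_shift[OF F] by blast+
  have "u' = \<tau> t u'"
    by (rule commuting_left_end_eq[of "\<nu> F" "\<nu> (shift t F)" _ "\<tau> t x'"])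
      (intro pl_\<nu> \<nu>_commute F F' ends)+
  then show False using tu' by simp
qed

lemma \<nu>_shift_eq_on_faithful_orbital:
  assumes f: "finsupp f" and p: "left_end (range \<tau>) p x"
    and faithful: "\<And>t. t \<noteq> 0 \<Longrightarrow> \<exists>y. left_end (range \<tau>) p y \<and> \<tau> t y \<noteq> y"
  shows "\<nu> f x = \<nu> (shift t f) x"
proof -
  have eq: "\<nu> g x = \<nu> (shift s g) x" if g: "finsupp g" "\<nu> g x \<noteq> x" for g s
  proof -
    obtain u where u: "left_end {\<nu> g} u x" using \<nu>_left_end_exists g by blast
    then have "\<tau> s u = u" using left_end_fixed_on_faithful_orbital[OF g(1) _ p] faithful by blast
    then show ?thesis using \<nu>_shift_eq_if_left_end_fixed[OF g(1) u] by blast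
  qed
  show ?thesis
  proof (cases "\<nu> f x = x")
    case True
    \<comment> \<open>Should the translate of f move x, the equality for it with - t leads back to
      f.\<close>
    then show ?thesis using eq[OF finsupp_shift[OF f, of t], of "- t"] by fastforce
  qed (use eq f in blast)
qed

lemma exists_shift_eq_on_orbital:
  assumes f: "finsupp f"
  shows "\<exists>t. t \<noteq> 0 \<and> (\<forall>x. left_end (range \<tau>) p x \<longrightarrow> \<nu> f x = \<nu> (shift t f) x)"
proof (cases "\<exists>t. t \<noteq> 0 \<and> (\<forall>y. left_end (range \<tau>) p y \<longrightarrow> \<tau> t y = y)")
  case True
  then show ?thesis using \<nu>_shift_eq_at_fixed_point[OF f] by blast
next
  case False
  \<comment> \<open>On a faithful orbital every t works; (1, 0) supplies a nonzero one.\<close>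
  moreover have "(1, 0) \<noteq> (0 :: int \<times> int)" by (simp add: zero_prod_def)
  ultimately show ?thesis using \<nu>_shift_eq_on_faithful_orbital[OF f] by blast
qed

text \<open>Passing from f to f minus a translate loses nothing gained on other orbitals: the
  conjugate by \<open>\<tau> t\<close> is trivial on the invariant set A too.\<close>

lemma \<nu>_shift_diff_fixes_invariant:
  assumes f: "finsupp f" and A: "\<And>x s. x \<in> A \<Longrightarrow> \<tau> s x \<in> A"
    and fix_f: "\<And>x. x \<in> A \<Longrightarrow> \<nu> f x = x" and x: "x \<in> A"
  shows "\<nu> (\<lambda>y. f y - shift t f y) x = x"
proof -
  have "\<nu> (shift t f) x = \<tau> t (\<nu> f (\<tau> (- t) x))"
    using \<tau>_\<nu>[OF f, of t "\<tau> (- t) x"] by (simp add: \<tau>_minus)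
  also have "\<dots> = x" using fix_f[OF A[OF x]] by (simp add: \<tau>_minus)
  finally show ?thesis
    using \<nu>_diff_fixes_iff[OF f finsupp_shift[OF f]] fix_f[OF x] by simp
qed

lemma fixed_by_generators:
  assumes "\<tau> (1, 0) x = x" "\<tau> (0, 1) x = x"
  shows "\<tau> t x = x"
proof -
  have mult: "\<tau> (k * i, k * j) x = x" if "\<tau> (i, j) x = x" for k i j
  proof (induction k rule: int_induct[of _ 0])
    case base
    show ?case using \<tau>_0 by (simp add: zero_prod_def)
  next
    case (step1 k)
    then show ?case using \<tau>_add[of "(i, j)" "(k * i, k * j)" x] that by (simp add: algebra_simps)
  next
    case (step2 k)
    have "\<tau> (i, j) (\<tau> ((k - 1) * i, (k - 1) * j) x) = \<tau> (k * i, k * j) x"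
      using \<tau>_add[of "(i, j)" "((k - 1) * i, (k - 1) * j)" x] by (simp add: algebra_simps)
    then have "\<tau> (i, j) (\<tau> ((k - 1) * i, (k - 1) * j) x) = \<tau> (i, j) x"
      using step2 that by simp
    then show ?case using pl_homeo_eq_iff[OF pl_\<tau>] by blast
  qed
  show ?thesis
    using mult[OF assms(1), of "fst t"] mult[OF assms(2), of "snd t"] \<tau>_add[of "(fst t, 0)" "(0, snd t)" x]
    by simp
qed

text \<open>Some generator of Z^2 moves a given point of an orbital and has the same left end there;
  each generator has finitely many.\<close>

lemma finite_left_ends_range: "finite {p. \<exists>x. left_end (range \<tau>) p x}"
proof (rule finite_subset)
  show "finite ({p. \<exists>x. left_end {\<tau> (1, 0)} p x} \<union> {p. \<exists>x. left_end {\<tau> (0, 1)} p x})"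
    by (simp add: finite_left_ends pl_\<tau>)
  show "{p. \<exists>x. left_end (range \<tau>) p x} \<subseteq>
      {p. \<exists>x. left_end {\<tau> (1, 0)} p x} \<union> {p. \<exists>x. left_end {\<tau> (0, 1)} p x}"
  proof
    fix p assume "p \<in> {p. \<exists>x. left_end (range \<tau>) p x}"
    then obtain x where x: "left_end (range \<tau>) p x" by blast
    then have "\<exists>t. \<tau> t x \<noteq> x" by (auto simp: left_end_def)
    then have "\<tau> (1, 0) x \<noteq> x \<or> \<tau> (0, 1) x \<noteq> x" using fixed_by_generators by blast
    then show "p \<in> {p. \<exists>x. left_end {\<tau> (1, 0)} p x} \<union> {p. \<exists>x. left_end {\<tau> (0, 1)} p x}"
      using left_end_translation[OF x] by blast
  qed
qed

section \<open>A nonzero element of the base group acting trivially\<close>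

lemma exists_nonzero_fixing_orbitals:
  assumes "finite P"
  shows "\<exists>f. finsupp f \<and> (\<exists>i. f i \<noteq> 0) \<and> (\<forall>x. (\<forall>t. \<tau> t x = x) \<longrightarrow> \<nu> f x = x) \<and>
    (\<forall>p\<in>P. \<forall>x. left_end (range \<tau>) p x \<longrightarrow> \<nu> f x = x)"
  using assms
proof (induction P)
  case empty
  \<comment> \<open>The element 1 - t of Z[Z^2] for t = (1, 0) acts trivially at all global fixed
    points.\<close>
  let ?g = "\<lambda>i :: int \<times> int. if i = 0 then 1 else 0 :: int"
  let ?f = "\<lambda>i. ?g i - shift (1, 0) ?g i"
  have g: "finsupp ?g" by simp
  have "\<nu> ?f x = x" if "\<forall>t. \<tau> t x = x" for x
    using \<nu>_diff_fixes_iff[OF g finsupp_shift[OF g]] \<nu>_shift_eq_at_fixed_point[OF g] that by blast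
  moreover have "?f 0 \<noteq> 0" by (simp add: zero_prod_def)
  moreover have "finsupp ?f" by (rule finsupp_diff[OF g finsupp_shift[OF g]])
  ultimately show ?case by (intro exI[of _ ?f] conjI exI[of _ 0]) auto
next
  case (insert p P)
  obtain f i where f: "finsupp f" "f i \<noteq> 0"
    and fixed: "\<forall>x. (\<forall>t. \<tau> t x = x) \<longrightarrow> \<nu> f x = x"
    and orb: "\<forall>q\<in>P. \<forall>x. left_end (range \<tau>) q x \<longrightarrow> \<nu> f x = x"
    using insert.IH by - (elim exE conjE, rule that)
  obtain t where t: "t \<noteq> 0" "\<And>x. left_end (range \<tau>) p x \<Longrightarrow> \<nu> f x = \<nu> (shift t f) x"
    using exists_shift_eq_on_orbital[OF f(1)] by blast
  let ?g = "\<lambda>y. f y - shift t f y"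
  have "finsupp ?g" by (rule finsupp_diff[OF f(1) finsupp_shift[OF f(1)]])
  \<comment> \<open>Otherwise f would be periodic under t.\<close>
  moreover have "\<exists>j. ?g j \<noteq> 0"
    using finsupp_periodic[OF f(1) t(1)] f(2) by (metis diff_eq_diff_eq diff_self)
  moreover have "\<nu> ?g x = x" if "\<forall>t. \<tau> t x = x" for x
    using \<nu>_shift_diff_fixes_invariant[OF f(1), of "{x. \<forall>t. \<tau> t x = x}"] fixed that by auto
  moreover have "\<nu> ?g x = x" if "q \<in> insert p P" "left_end (range \<tau>) q x" for q x
  proof (cases "q = p")
    case True
    then show ?thesis
      using t(2) that \<nu>_diff_fixes_iff[OF f(1) finsupp_shift[OF f(1)]] by simp
  next
    case False
    then show ?thesis
      using \<nu>_shift_diff_fixes_invariant[OF f(1), of "{x. left_end (range \<tau>) q x}"] orb that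
        left_end_range_invariant by auto
  qed
  ultimately show ?case by (intro exI[of _ ?g] conjI) auto
qed

lemma no_wreath_action: False
proof -
  obtain f i where f: "finsupp f" "f i \<noteq> 0"
    and fixed: "\<forall>x. (\<forall>t. \<tau> t x = x) \<longrightarrow> \<nu> f x = x"
    and orb: "\<forall>p\<in>{p. \<exists>x. left_end (range \<tau>) p x}. \<forall>x. left_end (range \<tau>) p x \<longrightarrow> \<nu> f x = x"
    using exists_nonzero_fixing_orbitals[OF finite_left_ends_range] by - (elim exE conjE, rule that)
  have "\<nu> f x = x" for x
  proof (cases "\<forall>t. \<tau> t x = x")
    case False
    then obtain p where "left_end (range \<tau>) p x"
      using left_end_exists[of "range \<tau>" _ x] pl_\<tau> by blast
    then show ?thesis using orb by blast
  qed (use fixed in blast)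
  then show False using \<nu>_faithful[OF f(1)] f(2) by blast
qed

end

section \<open>From PL_o(I) to homeomorphisms of the line\<close>

definition extend_id :: "(real \<Rightarrow> real) \<Rightarrow> real \<Rightarrow> real"
  where "extend_id f x = (if x \<in> {0..1} then f x else x)"

text \<open>Piecewise linearity is stated on open intervals; continuity carries the formula to the
  end points, as the germs require.\<close>

lemma affine_on_closed_interval:
  fixes f :: "real \<Rightarrow> real"
  assumes "continuous_on {a..b} f" "a < b" "\<forall>x\<in>{a<..<b}. f x = m * x + c" "x \<in> {a..b}"
  shows "f x = m * x + c"
proof -
  have "continuous_on (closure {a<..<b}) (\<lambda>x. f x - m * x)"
    using assms by (auto intro!: continuous_intros)
  then have "f x - m * x = c"
    by (rule continuous_constant_on_closure) (use assms in auto)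
  then show ?thesis by simp
qed

lemma finitely_piecewise_linear_right_germ:
  assumes f: "finitely_piecewise_linear_on {0..1} f" "continuous_on {0..1} f" and z: "0 \<le> z" "z < 1"
  shows "\<exists>m b. z < b \<and> b \<le> 1 \<and> (\<forall>x\<in>{z<..<b}. f x = f z + m * (x - z))"
proof -
  obtain B where B: "finite B"
    "\<And>a b. {a<..<b} \<subseteq> {0..1} - B \<Longrightarrow> \<exists>m c. \<forall>x\<in>{a<..<b}. f x = m * x + c"
    using f(1) unfolding finitely_piecewise_linear_on_def by blast
  have "\<forall>\<^sub>F x in at_right z. x \<notin> B"
    using islimpt_finite[OF B(1), of z] by (simp add: islimpt_iff_eventually eventually_at_split)
  then obtain b' where b': "z < b'" "\<And>x. z < x \<Longrightarrow> x < b' \<Longrightarrow> x \<notin> B"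
    unfolding eventually_at_right_field by blast
  define b where "b = min b' 1"
  have b: "z < b" "b \<le> 1" using b'(1) z by (simp_all add: b_def)
  have "{z<..<b} \<subseteq> {0..1} - B" using b'(2) z by (auto simp: b_def)
  then obtain m c where mc: "\<forall>x\<in>{z<..<b}. f x = m * x + c" using B(2) by blast
  have "continuous_on {z..b} f" using f(2) by (rule continuous_on_subset) (use z b in auto)
  then have "f z = m * z + c"
    using b(1) mc by (rule affine_on_closed_interval) (use b in auto)
  then show ?thesis using mc b by (intro exI[of _ m] exI[of _ b]) (simp add: algebra_simps)
qed

lemma finitely_piecewise_linear_left_germ:
  assumes f: "finitely_piecewise_linear_on {0..1} f" "continuous_on {0..1} f" and z: "0 < z" "z \<le> 1"
  shows "\<exists>m b. b < z \<and> 0 \<le> b \<and> (\<forall>x\<in>{b<..<z}. f x = f z + m * (x - z))"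
proof -
  obtain B where B: "finite B"
    "\<And>a b. {a<..<b} \<subseteq> {0..1} - B \<Longrightarrow> \<exists>m c. \<forall>x\<in>{a<..<b}. f x = m * x + c"
    using f(1) unfolding finitely_piecewise_linear_on_def by blast
  have "\<forall>\<^sub>F x in at_left z. x \<notin> B"
    using islimpt_finite[OF B(1), of z] by (simp add: islimpt_iff_eventually eventually_at_split)
  then obtain b' where b': "b' < z" "\<And>x. b' < x \<Longrightarrow> x < z \<Longrightarrow> x \<notin> B"
    unfolding eventually_at_left_field by blast
  define b where "b = max b' 0"
  have b: "b < z" "0 \<le> b" using b'(1) z by (simp_all add: b_def)
  have "{b<..<z} \<subseteq> {0..1} - B" using b'(2) z by (auto simp: b_def)
  then obtain m c where mc: "\<forall>x\<in>{b<..<z}. f x = m * x + c" using B(2) by blast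
  have "continuous_on {b..z} f" using f(2) by (rule continuous_on_subset) (use z b in auto)
  then have "f z = m * z + c"
    using b(1) mc by (rule affine_on_closed_interval) (use b in auto)
  then show ?thesis using mc b by (intro exI[of _ m] exI[of _ b]) (simp add: algebra_simps)
qed

lemma PLo_carrier_endpoints:
  assumes f: "f \<in> PLo_carrier"
  shows "f 0 = 0" "f 1 = 1"
proof -
  have im: "f ` {0..1} = {0..1}" and mono: "strict_mono_on {0..1} f"
    using f by (auto simp: PLo_carrier_iff Bij_def bij_betw_def)
  have le: "f x \<le> f y" if "x \<in> {0..1}" "y \<in> {0..1}" "x \<le> y" for x y
    using strict_mono_on_leD[OF mono] that by blast
  have in01: "f 0 \<in> {0..1}" "f 1 \<in> {0..1}" using im by auto
  have "0 \<in> f ` {0..1}" "1 \<in> f ` {0..1}" unfolding im by auto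
  then obtain x y where "x \<in> {0..1}" "f x = 0" "y \<in> {0..1}" "f y = 1" by auto
  then show "f 0 = 0" "f 1 = 1" using le[of 0 x] le[of y 1] in01 by auto
qed

lemma pl_homeo_extend_id:
  assumes f: "f \<in> PLo_carrier"
  shows "pl_homeo (extend_id f)"
proof -
  have im: "f ` {0..1} = {0..1}" and mono: "strict_mono_on {0..1} f"
    and cont: "continuous_on {0..1} f" and fpl: "finitely_piecewise_linear_on {0..1} f"
    using f by (auto simp: PLo_carrier_iff Bij_def bij_betw_def)
  note ends = PLo_carrier_endpoints[OF f]
  have in01: "f x \<in> {0..1}" if "x \<in> {0..1}" for x using im that by blast
  have "strict_mono (extend_id f)"
  proof (rule strict_monoI)
    fix x y :: real assume xy: "x < y"
    consider "x \<in> {0..1}" "y \<in> {0..1}" | "x \<notin> {0..1} \<or> y \<notin> {0..1}" by blast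
    then show "extend_id f x < extend_id f y"
    proof cases
      case 1
      then show ?thesis using strict_mono_onD[OF mono _ _ xy] by (simp add: extend_id_def)
    next
      case 2
      then show ?thesis using xy in01[of x] in01[of y] by (auto simp: extend_id_def)
    qed
  qed
  moreover have "surj (extend_id f)"
    unfolding surj_def
  proof
    fix y
    show "\<exists>x. y = extend_id f x"
    proof (cases "y \<in> {0..1}")
      case True
      then have "y \<in> f ` {0..1}" unfolding im .
      then show ?thesis unfolding extend_id_def by force
    qed (auto simp: extend_id_def)
  qed
  moreover have out: "extend_id f x = x" if "x \<notin> {0<..<1}" for x
    using ends that by (cases "x = 0 \<or> x = 1") (auto simp: extend_id_def)
  moreover have "\<exists>m. \<forall>\<^sub>F x in at_right z. extend_id f x = extend_id f z + m * (x - z)" for z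
  proof (cases "0 \<le> z \<and> z < 1")
    case True
    then obtain m b where b: "z < b" "b \<le> 1" "\<forall>x\<in>{z<..<b}. f x = f z + m * (x - z)"
      using finitely_piecewise_linear_right_germ[OF fpl cont] by blast
    then show ?thesis
      unfolding eventually_at_right_field using True
      by (intro exI[of _ m] exI[of _ b]) (auto simp: extend_id_def)
  next
    \<comment> \<open>Outside [0, 1) the extension is the identity just to the right of z.\<close>
    case False
    have "\<exists>b>z. \<forall>x>z. x < b \<longrightarrow> extend_id f x = extend_id f z + 1 * (x - z)"
      using False by (intro exI[of _ "if z < 0 then 0 else z + 1"]) (auto simp: out)
    then show ?thesis unfolding eventually_at_right_field by blast
  qed
  moreover have "\<exists>m. \<forall>\<^sub>F x in at_left z. extend_id f x = extend_id f z + m * (x - z)" for z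
  proof (cases "0 < z \<and> z \<le> 1")
    case True
    then obtain m b where b: "b < z" "0 \<le> b" "\<forall>x\<in>{b<..<z}. f x = f z + m * (x - z)"
      using finitely_piecewise_linear_left_germ[OF fpl cont] by blast
    then show ?thesis
      unfolding eventually_at_left_field using True
      by (intro exI[of _ m] exI[of _ b]) (auto simp: extend_id_def)
  next
    case False
    have "\<exists>b<z. \<forall>x>b. x < z \<longrightarrow> extend_id f x = extend_id f z + 1 * (x - z)"
      using False by (intro exI[of _ "if 1 < z then 1 else z - 1"]) (auto simp: out)
    then show ?thesis unfolding eventually_at_left_field by blast
  qed
  ultimately show ?thesis unfolding pl_homeo_def by blast
qed

lemma carrier_PLo: "carrier PLo = PLo_carrier"
  by (simp add: PLo_def)

lemma one_PLo: "\<one>\<^bsub>PLo\<^esub> = (\<lambda>x\<in>{0..1}. x)"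
  by (simp add: PLo_def BijGroup_def)

lemma extend_id_mult_PLo:
  assumes "f \<in> carrier PLo" "g \<in> carrier PLo"
  shows "extend_id (f \<otimes>\<^bsub>PLo\<^esub> g) x = extend_id f (extend_id g x)"
proof -
  have fg: "f \<in> Bij {0..1}" "g \<in> Bij {0..1}" using assms PLo_carrier_subset_Bij by (auto simp: carrier_PLo)
  then have "f \<otimes>\<^bsub>PLo\<^esub> g = compose {0..1} f g" by (simp add: PLo_def BijGroup_def)
  moreover have "g y \<in> {0..1}" if "y \<in> {0..1}" for y using fg(2) that Bij_imp_funcset by blast
  ultimately show ?thesis by (auto simp: extend_id_def compose_def)
qed

lemma extend_id_eq_idD:
  assumes "f \<in> carrier PLo" "\<And>x. extend_id f x = x"
  shows "f = \<one>\<^bsub>PLo\<^esub>"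
proof -
  have "f \<in> extensional {0..1}"
    using assms(1) PLo_carrier_subset_Bij Bij_imp_extensional by (auto simp: carrier_PLo)
  moreover have "f x = x" if "x \<in> {0..1}" for x
    using assms(2)[of x] that by (simp add: extend_id_def)
  ultimately show ?thesis unfolding one_PLo by (intro ext) (auto simp: extensional_def)
qed

section \<open>The wreath product in coordinates and the conclusion\<close>

abbreviation ZwrZ2 :: "((int \<times> int \<Rightarrow> int) \<times> int \<times> int) monoid"
  where "ZwrZ2 \<equiv> wreath_product integer_group (integer_group \<times>\<times> integer_group)"

lemma carrier_ZwrZ2: "carrier ZwrZ2 = {f. finsupp f} \<times> UNIV"
  by (auto simp: wreath_product_def semidirect_product_def carrier_sum_group DirProd_def)

lemma mult_ZwrZ2: "(f, s) \<otimes>\<^bsub>ZwrZ2\<^esub> (g, t) = ((\<lambda>x. f x + shift s g x), s + t)"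
proof -
  have "inv\<^bsub>integer_group \<times>\<times> integer_group\<^esub> s = - s" for s :: "int \<times> int"
    by (cases s) (simp add: inv_DirProd)
  then show ?thesis
    by (cases s; cases t)
      (auto simp: wreath_product_def semidirect_product_def translate_def fun_eq_iff DirProd_def
        plus_prod_def minus_prod_def)
qed

lemma one_ZwrZ2: "\<one>\<^bsub>ZwrZ2\<^esub> = (\<lambda>_. 0, 0)"
  by (auto simp: wreath_product_def semidirect_product_def DirProd_def zero_prod_def)

lemma group_ZwrZ2: "group ZwrZ2"
  by (intro group_wreath_product DirProd_group) simp_all

theorem lemma4p3:
  shows "\<not> (\<exists>\<phi>. \<phi> \<in> mon (wreath_product integer_group (integer_group \<times>\<times> integer_group)) PLo)"
proof
  assume "\<exists>\<phi>. \<phi> \<in> mon ZwrZ2 PLo"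
  then obtain \<phi> where hom: "\<phi> \<in> hom ZwrZ2 PLo" and inj: "inj_on \<phi> (carrier ZwrZ2)"
    by (auto simp: mon_def)
  define \<psi> where "\<psi> w = extend_id (\<phi> w)" for w
  have carr: "\<phi> w \<in> carrier PLo" if "w \<in> carrier ZwrZ2" for w
    using hom that by (auto simp: hom_def)
  have \<psi>_pl: "pl_homeo (\<psi> w)" if "w \<in> carrier ZwrZ2" for w
    using pl_homeo_extend_id carr[OF that] by (simp add: \<psi>_def carrier_PLo)
  have \<psi>_mult: "\<psi> v (\<psi> w y) = \<psi> (v \<otimes>\<^bsub>ZwrZ2\<^esub> w) y"
    if "v \<in> carrier ZwrZ2" "w \<in> carrier ZwrZ2" for v w y
    using hom_mult[OF hom that] extend_id_mult_PLo carr that by (simp add: \<psi>_def)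
  have \<psi>_inj: "w = \<one>\<^bsub>ZwrZ2\<^esub>" if w: "w \<in> carrier ZwrZ2" "\<And>x. \<psi> w x = x" for w
  proof -
    have "\<phi> w = \<phi> \<one>\<^bsub>ZwrZ2\<^esub>"
      using extend_id_eq_idD[OF carr] w hom_one[OF hom group_ZwrZ2 group_PLo] by (simp add: \<psi>_def)
    then show ?thesis
      using inj w(1) group.is_monoid[OF group_ZwrZ2] monoid.one_closed by (metis inj_on_def)
  qed
  \<comment> \<open>The relation \<open>\<tau>_\<nu>\<close> holds because (0, t) (f, 0) and
    (\<open>shift t f\<close>, 0) (0, t) both equal (\<open>shift t f\<close>, t).\<close>
  interpret wreath_action "\<lambda>f. \<psi> (f, 0)" "\<lambda>t. \<psi> (\<lambda>_. 0, t)"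
  proof
    show "f i = 0" if "finsupp f" "\<And>x. \<psi> (f, 0) x = x" for f i
      using \<psi>_inj[of "(f, 0)"] that by (simp add: carrier_ZwrZ2 one_ZwrZ2)
  qed (simp_all add: \<psi>_pl \<psi>_mult carrier_ZwrZ2 mult_ZwrZ2 finsupp_shift)
  show False by (rule no_wreath_action)
qed

end
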